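(* Assume A1, A2, A3, A4 and A5 on the model, and B1 and B2 on the penalties (all stated in the context). Then the order estimator $$\hat k_n=\min\ \underset{k\in[\bar k]}{\arg\min}\Big\{\min_{\psi_k\in\mathbb{S}_k}\ell_{k,n}(\psi_k)+\mathrm{pen}_{k,n}\Big\}$$ is consistent, that is, $\lim_{n\to\infty}\mathrm{P}(\hat k_n=k_0)=1$.
   Context: Setting. $(\Omega,\mathcal{A},\mathrm{P})$ is a probability space with expectation $\mathrm{E}$; $X:\Omega\to\mathbb{X}$ is a random map with density $f_0:\mathbb{X}\to\mathbb{R}_{>0}$ with respect to a measure $\mathfrak{m}$ on $(\mathbb{X},\mathcal{B}(\mathbb{X}))$; $P$ denotes the law of $X$. $\mathbb{T}\subset\mathbb{R}^m$ and $\phi:\mathbb{X}\times\mathbb{T}\to\mathbb{R}_{>0}$ satisfies $\int_{\mathbb{X}}\phi(x;\theta)\,\mathfrak{m}(\mathrm{d}x)=1$ for each $\theta\in\mathbb{T}$. Write $[k]=\{1,\dots,k\}$. For $k\in\mathbb{N}$, $$\mathcal{M}_k^\phi=\Big\{x\mapsto f_k(x;\psi_k)=\sum_{z=1}^k\pi_z\phi(x;\theta_z):\ \theta_z\in\mathbb{T},\ \pi_z\in[0,1],\ \sum_{z=1}^k\pi_z=1\Big\},\qquad \mathcal{M}_0^\phi=\varnothing,$$ where $\psi_k=(\pi_1,\dots,\pi_k,\theta_1,\dots,\theta_k)$ ranges over $\mathbb{S}_k=\{(\pi_1,\dots,\pi_k)\in[0,1]^k:\sum_z\pi_z=1\}\times\mathbb{T}^k$.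 $\bar k\in\mathbb{N}$ is fixed. Densities are identified when they agree $\mathfrak{m}$-almost everywhere. For a sample $X_1,\dots,X_n$, put $\ell_{k,n}(\psi_k)=-n^{-1}\sum_{i=1}^n\log f_k(X_i;\psi_k)$. For each $k\in[\bar k]$ and $n$, $\mathrm{pen}_{k,n}$ is a real number (penalty). All random quantities of interest are assumed measurable. A1: $f_0\in\mathcal{M}_{k_0}^\phi\setminus\mathcal{M}_{k_0-1}^\phi$ for some $k_0\in[\bar k]$, and $X_1,\dots,X_n$ are IID replicates of $X$. A2: $\phi(x;\theta)>0$ for each $x\in\mathbb{X}$, $\theta\in\mathbb{T}$, and $\mathbb{T}\subset\mathbb{R}^m$ is compact. A3: $\phi(x;\cdot):\mathbb{T}\to\mathbb{R}$ is continuous for each fixed $x$, and $\phi(\cdot;\theta):\mathbb{X}\to\mathbb{R}$ is measurable for each fixed $\theta$. A4: there is $G_1\in\mathcal{L}_1(P)$ with $\max_{\theta\in\mathbb{T}}|\log\phi(x;\theta)|<G_1(x)$ for every $x\in\mathbb{X}$. A5: there are $L_\phi:\mathbb{X}\to\mathbb{R}_{\ge0}$ and $G_2\in\mathcal{L}_1(\mathfrak{m})$ such that for all $\theta_1,\theta_2\in\mathbb{T}$ and $x\in\mathbb{X}$, $|\phi(x;\theta_1)-\phi(x;\theta_2)|\le L_\phi(x)\|\theta_1-\theta_2\|_1$, and $\max_{\theta\in\mathbb{T}}\phi(x;\theta)+L_\phi(x)\le G_2(x)$. B1: for each $k\in[\bar k]$, $\lim_{n\to\infty}\mathrm{pen}_{k,n}=0$.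 B2: for each $1\le k<l\le\bar k$, $\lim_{n\to\infty}\frac{n}{\log n}\{\mathrm{pen}_{l,n}-\mathrm{pen}_{k,n}\}=\infty$. *)

theory Defs
  imports "HOL-Probability.Probability"
begin

definition norm1 :: "real ^ 'd \<Rightarrow> real" where
  "norm1 v = (\<Sum>i\<in>UNIV. \<bar>v $ i\<bar>)"

text \<open>The parameter \<open>\<psi>\<^sub>k\<close> is a pair of extensional functions on \<open>{1..k}\<close>: weights and atoms.
  For \<open>k = 0\<close> the weights would have to satisfy \<open>0 = 1\<close>, so the parameter space, and with it
  the mixture class, is empty.\<close>

type_synonym 'd param = "(nat \<Rightarrow> real) \<times> (nat \<Rightarrow> real ^ 'd)"

definition param_space :: "(real ^ 'd) set \<Rightarrow> nat \<Rightarrow> 'd param set" where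
  "param_space T k = {w \<in> {1..k} \<rightarrow>\<^sub>E {0..1}. (\<Sum>z=1..k. w z) = 1} \<times> ({1..k} \<rightarrow>\<^sub>E T)"

definition mixture :: "('x \<Rightarrow> real ^ 'd \<Rightarrow> real) \<Rightarrow> nat \<Rightarrow> 'd param \<Rightarrow> 'x \<Rightarrow> real" where
  "mixture \<phi> k \<psi> x = (\<Sum>z=1..k. fst \<psi> z * \<phi> x (snd \<psi> z))"

definition mixture_class ::
  "('x \<Rightarrow> real ^ 'd \<Rightarrow> real) \<Rightarrow> (real ^ 'd) set \<Rightarrow> nat \<Rightarrow> ('x \<Rightarrow> real) set" where
  "mixture_class \<phi> T k = mixture \<phi> k ` param_space T k"

text \<open>Membership in a class of densities that are identified when they agree almost everywhere.\<close>

definition ae_member :: "'x measure \<Rightarrow> ('x \<Rightarrow> real) \<Rightarrow> ('x \<Rightarrow> real) set \<Rightarrow> bool" where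
  "ae_member \<mm> f F \<longleftrightarrow> (\<exists>g\<in>F. AE x in \<mm>. f x = g x)"

definition neg_loglik ::
  "('x \<Rightarrow> real ^ 'd \<Rightarrow> real) \<Rightarrow> (nat \<Rightarrow> 'x) \<Rightarrow> nat \<Rightarrow> nat \<Rightarrow> 'd param \<Rightarrow> real" where
  "neg_loglik \<phi> xs n k \<psi> = - (1 / real n) * (\<Sum>i=1..n. ln (mixture \<phi> k \<psi> (xs i)))"

text \<open>The \<open>LEAST\<close> below is a minimum over an infinite set of reals. It is attained as soon as the
  parameter set \<open>T\<close> is compact and nonempty, \<open>k \<ge> 1\<close>, and \<open>\<phi>\<close> is positive and continuous
  in the parameter at each sample point.\<close>

definition pen_criterion ::
  "('x \<Rightarrow> real ^ 'd \<Rightarrow> real) \<Rightarrow> (real ^ 'd) set \<Rightarrow> (nat \<Rightarrow> nat \<Rightarrow> real) \<Rightarrow>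
    (nat \<Rightarrow> 'x) \<Rightarrow> nat \<Rightarrow> nat \<Rightarrow> real" where
  "pen_criterion \<phi> T pen xs n k =
     (LEAST v. v \<in> neg_loglik \<phi> xs n k ` param_space T k) + pen k n"

definition order_estimator ::
  "('x \<Rightarrow> real ^ 'd \<Rightarrow> real) \<Rightarrow> (real ^ 'd) set \<Rightarrow> (nat \<Rightarrow> nat \<Rightarrow> real) \<Rightarrow> nat \<Rightarrow>
    (nat \<Rightarrow> 'x) \<Rightarrow> nat \<Rightarrow> nat" where
  "order_estimator \<phi> T pen kbar xs n =
     Min {k. is_arg_min (pen_criterion \<phi> T pen xs n) (\<lambda>k. k \<in> {1..kbar}) k}"

end

theory Submission
  imports Defs
begin

text \<open>
  Replace \<open>f\<^sub>0\<close> by the mixture \<open>g\<close> of order \<open>k\<^sub>0\<close> that agrees with it almost everywhere. A net of mesh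
  \<open>1/N\<close> in the parameter space of order \<open>k\<close> has polynomially many points \<open>p\<close>, and every mixture lies
  below one of the upper brackets \<open>u\<^sub>p = f\<^sub>p + (C/N) G\<^sub>2\<close>. By independence and Markov's inequality, the
  product of \<open>(u\<^sub>p/g)\<^sup>\<alpha>\<close> over \<open>n\<close> observations exceeds \<open>a\<close> with probability at most
  \<open>(\<integral> (u\<^sub>p/g)\<^sup>\<alpha> g)\<^sup>n / a\<close>; a union bound over the net controls the supremum of the log-likelihood ratio.

  With \<open>\<alpha> = 1\<close> and \<open>N = n\<close> the integral is \<open>1 + O(1/n)\<close>, its \<open>n\<close>-th power is bounded, and the supremum
  is at most a multiple of \<open>log n\<close>, which the penalty gap B2 beats for \<open>k > k\<^sub>0\<close>. With \<open>\<alpha> = 1/2\<close> and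
  \<open>N\<close> fixed but large the integral is close to a Hellinger affinity; for \<open>k < k\<^sub>0\<close> compactness keeps it
  away from \<open>1\<close>, so the supremum is below \<open>-\<epsilon> n\<close>, which penalties tending to \<open>0\<close> cannot compensate.
\<close>

section \<open>Parameter space, mixture classes and the order estimate\<close>

text \<open>Tychonoff: an extensional product over \<open>I\<close> is a full product whose factors
  outside \<open>I\<close> are the singleton of \<open>undefined\<close>, hence also
  compact.\<close>

lemma compact_PiE_extensional:
  fixes S :: "'i \<Rightarrow> 'a::topological_space set"
  assumes "\<And>i. i \<in> I \<Longrightarrow> compact (S i)"
  shows "compact (Pi\<^sub>E I S)"
proof -
  define S' where "S' i = (if i \<in> I then S i else {undefined})" for i
  have "Pi\<^sub>E I S = Pi\<^sub>E UNIV S'"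
    unfolding S'_def PiE_def extensional_def Pi_def by (auto split: if_splits)
  moreover have "compactin (product_topology (\<lambda>i. euclidean) UNIV) (Pi\<^sub>E UNIV S')"
    unfolding compactin_PiE using assms by (auto simp: S'_def)
  ultimately show ?thesis
    by (simp add: euclidean_product_topology)
qed

lemma compact_param_space:
  fixes T :: "(real ^ 'd) set"
  assumes "compact T"
  shows "compact (param_space T k)"
proof -
  have "closed {w :: nat \<Rightarrow> real. (\<Sum>z=1..k. w z) = 1}"
    by (intro closed_Collect_eq continuous_intros continuous_on_product_coordinates)
  then have "compact (({1..k} \<rightarrow>\<^sub>E {0..1}) \<inter> {w :: nat \<Rightarrow> real. (\<Sum>z=1..k. w z) = 1})"
    by (intro compact_Int_closed compact_PiE_extensional) auto
  moreover have "({1..k} \<rightarrow>\<^sub>E {0..1}) \<inter> {w :: nat \<Rightarrow> real. (\<Sum>z=1..k. w z) = 1} =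
      {w \<in> {1..k} \<rightarrow>\<^sub>E {0..1}. (\<Sum>z=1..k. w z) = 1}"
    by auto
  ultimately show ?thesis
    unfolding param_space_def using assms
    by (intro compact_Times compact_PiE_extensional) auto
qed

lemma param_spaceD:
  assumes "\<psi> \<in> param_space T k" "z \<in> {1..k}"
  shows "0 \<le> fst \<psi> z" "fst \<psi> z \<le> 1" "snd \<psi> z \<in> T"
  using assms by (auto simp: param_space_def PiE_iff)

lemma param_space_sum: "\<psi> \<in> param_space T k \<Longrightarrow> (\<Sum>z=1..k. fst \<psi> z) = 1"
  by (auto simp: param_space_def)

lemma param_space_nonempty:
  assumes "1 \<le> k" "T \<noteq> {}"
  shows "param_space T k \<noteq> {}"
proof -
  obtain \<theta> where "\<theta> \<in> T" using assms by auto
  then have "(\<lambda>z\<in>{1..k}. if z = 1 then 1 else 0, \<lambda>z\<in>{1..k}. \<theta>) \<in> param_space T k"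
    using assms by (auto simp: param_space_def PiE_iff)
  then show ?thesis by auto
qed

text \<open>Pad with components of weight zero; any point of \<open>T\<close> serves as their atom.
  This turns non-membership at order \<open>k0 - 1\<close> into non-membership at every smaller
  order.\<close>

lemma mixture_class_mono:
  assumes "j \<le> k" "T \<noteq> {}"
  shows "mixture_class \<phi> T j \<subseteq> mixture_class \<phi> T k"
proof
  fix f assume "f \<in> mixture_class \<phi> T j"
  then obtain \<psi> where \<psi>: "\<psi> \<in> param_space T j" "f = mixture \<phi> j \<psi>"
    by (auto simp: mixture_class_def)
  obtain \<theta> where \<theta>: "\<theta> \<in> T" using assms by auto
  define \<psi>' where "\<psi>' = (\<lambda>z\<in>{1..k}. if z \<le> j then fst \<psi> z else 0,
                          \<lambda>z\<in>{1..k}. if z \<le> j then snd \<psi> z else \<theta>)"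
  have sub: "(\<Sum>z=1..k. if z \<le> j then h z else 0) = (\<Sum>z=1..j. h z)" for h :: "nat \<Rightarrow> real"
    using assms by (intro sum.mono_neutral_cong_right) auto
  have "(\<Sum>z=1..k. fst \<psi>' z) = (\<Sum>z=1..k. if z \<le> j then fst \<psi> z else 0)"
    by (intro sum.cong) (auto simp: \<psi>'_def)
  also have "\<dots> = 1"
    using \<psi> by (simp only: sub param_space_sum)
  finally have "(\<Sum>z=1..k. fst \<psi>' z) = 1" .
  with \<psi> \<theta> have "\<psi>' \<in> param_space T k"
    by (auto simp: param_space_def PiE_iff \<psi>'_def)
  moreover have "mixture \<phi> k \<psi>' x = f x" for x
  proof -
    have "mixture \<phi> k \<psi>' x = (\<Sum>z=1..k. if z \<le> j then fst \<psi> z * \<phi> x (snd \<psi> z) else 0)"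
      unfolding mixture_def by (intro sum.cong) (auto simp: \<psi>'_def)
    then show ?thesis by (simp only: sub \<psi> mixture_def)
  qed
  ultimately show "f \<in> mixture_class \<phi> T k"
    unfolding mixture_class_def by (metis ext imageI)
qed

text \<open>A strict minimizer makes the arg min set a singleton, so ties and the outer
  \<open>Min\<close> disappear. Consistency thus reduces to strict comparisons of \<open>k0\<close>
  with each competitor.\<close>

lemma order_estimator_eqI:
  assumes "j \<in> {1..kbar}"
    and "\<And>k. k \<in> {1..kbar} \<Longrightarrow> k \<noteq> j \<Longrightarrow> pen_criterion \<phi> T pen xs n j < pen_criterion \<phi> T pen xs n k"
  shows "order_estimator \<phi> T pen kbar xs n = j"
proof -
  have "{k. is_arg_min (pen_criterion \<phi> T pen xs n) (\<lambda>k. k \<in> {1..kbar}) k} = {j}"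
  proof (intro equalityI subsetI; clarsimp simp only: mem_Collect_eq singleton_iff is_arg_min_def)
    fix k assume k: "k \<in> {1..kbar}"
      and "\<not> (\<exists>y. y \<in> {1..kbar} \<and> pen_criterion \<phi> T pen xs n y < pen_criterion \<phi> T pen xs n k)"
    then show "k = j" using assms by blast
  next
    show "j \<in> {1..kbar} \<and>
        \<not> (\<exists>y. y \<in> {1..kbar} \<and> pen_criterion \<phi> T pen xs n y < pen_criterion \<phi> T pen xs n j)"
      using assms order_less_asym by blast
  qed
  then show ?thesis by (simp add: order_estimator_def)
qed

section \<open>Nets in bounded real coordinates\<close>

text \<open>Points whose coordinates, scaled by \<open>n\<close>, have the same floors are within
  \<open>1 / n\<close> of each other, so one representative per cell suffices. Representatives are
  taken from \<open>S\<close> itself and not from a grid, because net points must again be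
  parameters.\<close>

lemma finite_coordinate_net:
  fixes c :: "'p \<Rightarrow> 'i \<Rightarrow> real"
  assumes I: "finite I" and n: "n \<ge> 1" and B: "\<And>p i. p \<in> S \<Longrightarrow> i \<in> I \<Longrightarrow> \<bar>c p i\<bar> \<le> real B"
  shows "\<exists>P\<subseteq>S. finite P \<and> card P \<le> (2 * B * n + 1) ^ card I \<and>
           (\<forall>p\<in>S. \<exists>p'\<in>P. \<forall>i\<in>I. \<bar>c p i - c p' i\<bar> \<le> 1 / real n)"
proof -
  \<comment> \<open>The cell of \<open>p\<close>: one integer per coordinate, made extensional so
    that the possible cells lie in a finite function space.\<close>
  define q where "q p = (\<lambda>i\<in>I. \<lfloor>real n * c p i\<rfloor>)" for p
  define R where "R = {- (int B * int n)..int B * int n}"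
  have "q p \<in> I \<rightarrow>\<^sub>E R" if "p \<in> S" for p
  proof -
    have "\<lfloor>real n * c p i\<rfloor> \<in> R" if "i \<in> I" for i
    proof -
      have "\<bar>real n * c p i\<bar> \<le> real n * real B"
        using B[OF \<open>p \<in> S\<close> that] by (simp add: abs_mult mult_left_mono)
      then show ?thesis
        unfolding R_def by (auto simp: le_floor_iff floor_le_iff mult.commute abs_le_iff)
    qed
    then show ?thesis by (simp add: q_def)
  qed
  then have sub: "q ` S \<subseteq> I \<rightarrow>\<^sub>E R" by auto
  have fin: "finite (I \<rightarrow>\<^sub>E R)" using I by (intro finite_PiE) (auto simp: R_def)
  have "card (q ` S) \<le> card (I \<rightarrow>\<^sub>E R)" by (rule card_mono[OF fin sub])
  also have "card (I \<rightarrow>\<^sub>E R) = card R ^ card I" by (rule card_funcsetE[OF I])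
  also have "card R = 2 * B * n + 1"
    unfolding R_def by (simp add: nat_eq_iff)
  finally have card: "card (q ` S) \<le> (2 * B * n + 1) ^ card I" .
  have finq: "finite (q ` S)" using finite_subset[OF sub fin] .
  define P where "P = inv_into S q ` (q ` S)"
  have "\<exists>p'\<in>P. \<forall>i\<in>I. \<bar>c p i - c p' i\<bar> \<le> 1 / real n" if p: "p \<in> S" for p
  proof (intro bexI ballI)
    show "inv_into S q (q p) \<in> P" using p by (auto simp: P_def)
    fix i assume i: "i \<in> I"
    have "q (inv_into S q (q p)) i = q p i" using p by (simp add: f_inv_into_f)
    then have "\<lfloor>real n * c (inv_into S q (q p)) i\<rfloor> = \<lfloor>real n * c p i\<rfloor>"
      using i by (simp add: q_def)
    then have "\<bar>real n * c p i - real n * c (inv_into S q (q p)) i\<bar> \<le> 1" by linarith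
    then have "real n * \<bar>c p i - c (inv_into S q (q p)) i\<bar> \<le> 1"
      by (simp add: abs_mult flip: right_diff_distrib)
    then show "\<bar>c p i - c (inv_into S q (q p)) i\<bar> \<le> 1 / real n"
      using n by (simp add: field_simps)
  qed
  moreover have "P \<subseteq> S" unfolding P_def by (auto intro: inv_into_into)
  moreover have "card P \<le> card (q ` S)" unfolding P_def by (rule card_image_le[OF finq])
  ultimately show ?thesis using card finq unfolding P_def
    by (intro exI[of _ "inv_into S q ` (q ` S)"]) auto
qed

section \<open>The sampling model and elementary properties of mixtures\<close>

text \<open>The sampling density is taken to be a mixture on the nose rather than almost everywhere, so that
  it is positive, and likelihood ratios make sense, at every point of the space.\<close>

locale mixture_sample = prob_space M for M :: "'w measure" +
  fixes \<mm> :: "'x measure" and T :: "(real ^ 'd) set" and \<phi> :: "'x \<Rightarrow> real ^ 'd \<Rightarrow> real"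
    and G L :: "'x \<Rightarrow> real" and Xs :: "nat \<Rightarrow> 'w \<Rightarrow> 'x" and k0 :: nat and \<psi>0 :: "'d param"
  assumes T_compact: "compact T"
    and phi_pos: "\<And>x \<theta>. x \<in> space \<mm> \<Longrightarrow> \<theta> \<in> T \<Longrightarrow> 0 < \<phi> x \<theta>"
    and phi_cont: "\<And>x. x \<in> space \<mm> \<Longrightarrow> continuous_on T (\<phi> x)"
    and phi_density: "\<And>\<theta>. \<theta> \<in> T \<Longrightarrow> (\<integral>x. \<phi> x \<theta> \<partial>\<mm>) = 1"
    and G_integrable: "integrable \<mm> G"
    and L_nonneg: "\<And>x. x \<in> space \<mm> \<Longrightarrow> 0 \<le> L x"
    and phi_Lipschitz: "\<And>x \<theta> \<theta>'. x \<in> space \<mm> \<Longrightarrow> \<theta> \<in> T \<Longrightarrow> \<theta>' \<in> T \<Longrightarrow>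
      \<bar>\<phi> x \<theta> - \<phi> x \<theta>'\<bar> \<le> L x * norm1 (\<theta> - \<theta>')"
    and envelope: "\<And>x \<theta>. x \<in> space \<mm> \<Longrightarrow> \<theta> \<in> T \<Longrightarrow> \<phi> x \<theta> + L x \<le> G x"
    and indep: "indep_vars (\<lambda>_. \<mm>) Xs {1..}"
    and k0: "1 \<le> k0"
    and psi0: "\<psi>0 \<in> param_space T k0"
    and law: "\<And>i. 1 \<le> i \<Longrightarrow> distr M \<mm> (Xs i) = density \<mm> (\<lambda>x. ennreal (mixture \<phi> k0 \<psi>0 x))"
begin

abbreviation g :: "'x \<Rightarrow> real" where "g \<equiv> mixture \<phi> k0 \<psi>0"

lemma T_nonempty: "T \<noteq> {}"
  using param_spaceD(3)[OF psi0, of 1] k0 by auto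

lemma Xs_meas: "1 \<le> i \<Longrightarrow> Xs i \<in> measurable M \<mm>"
  using indep by (auto simp: indep_vars_def)

lemma Xs_space: "1 \<le> i \<Longrightarrow> \<omega> \<in> space M \<Longrightarrow> Xs i \<omega> \<in> space \<mm>"
  by (rule measurable_space[OF Xs_meas])

lemma L_le_G: "x \<in> space \<mm> \<Longrightarrow> L x \<le> G x"
  and phi_le_G: "x \<in> space \<mm> \<Longrightarrow> \<theta> \<in> T \<Longrightarrow> \<phi> x \<theta> \<le> G x"
  and G_pos: "x \<in> space \<mm> \<Longrightarrow> 0 < G x"
proof -
  obtain \<theta>1 where "\<theta>1 \<in> T" using T_nonempty by auto
  then show "x \<in> space \<mm> \<Longrightarrow> L x \<le> G x" "x \<in> space \<mm> \<Longrightarrow> 0 < G x"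
    using phi_pos envelope L_nonneg by fastforce+
  show "x \<in> space \<mm> \<Longrightarrow> \<theta> \<in> T \<Longrightarrow> \<phi> x \<theta> \<le> G x"
    using envelope L_nonneg by fastforce
qed

text \<open>The Bochner integral of a non-integrable function is 0, so the value 1 forces
  integrability.\<close>

lemma phi_integrable: "\<theta> \<in> T \<Longrightarrow> integrable \<mm> (\<lambda>x. \<phi> x \<theta>)"
  using phi_density not_integrable_integral_eq by fastforce

context
  fixes k \<psi> assumes psi: "\<psi> \<in> param_space T k"
begin

lemma mixture_integrable: "integrable \<mm> (mixture \<phi> k \<psi>)"
  unfolding mixture_def using phi_integrable param_spaceD(3)[OF psi]
  by (intro Bochner_Integration.integrable_sum integrable_mult_right) auto

lemma mixture_meas: "mixture \<phi> k \<psi> \<in> borel_measurable \<mm>"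
  using mixture_integrable by auto

lemma mixture_integral: "(\<integral>x. mixture \<phi> k \<psi> x \<partial>\<mm>) = 1"
proof -
  have "(\<integral>x. mixture \<phi> k \<psi> x \<partial>\<mm>) = (\<Sum>z=1..k. fst \<psi> z * (\<integral>x. \<phi> x (snd \<psi> z) \<partial>\<mm>))"
    unfolding mixture_def using phi_integrable param_spaceD(3)[OF psi]
    by (subst Bochner_Integration.integral_sum) auto
  also have "\<dots> = (\<Sum>z=1..k. fst \<psi> z)"
    using phi_density param_spaceD(3)[OF psi] by (intro sum.cong) auto
  finally show ?thesis using param_space_sum[OF psi] by simp
qed

lemma mixture_pos: "x \<in> space \<mm> \<Longrightarrow> 0 < mixture \<phi> k \<psi> x"
proof -
  assume x: "x \<in> space \<mm>"
  \<comment> \<open>Weights that sum to 1 cannot all vanish; one positive term is enough, since the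
    others are nonnegative.\<close>
  have "\<exists>z\<in>{1..k}. fst \<psi> z \<noteq> 0"
    using param_space_sum[OF psi] sum.neutral[of "{1..k}" "fst \<psi>"] by fastforce
  then obtain z where z: "z \<in> {1..k}" "fst \<psi> z \<noteq> 0" by auto
  then have "0 < fst \<psi> z" using param_spaceD(1)[OF psi z(1)] by simp
  then show ?thesis
    unfolding mixture_def using z x phi_pos param_spaceD[OF psi]
    by (intro sum_pos2[of _ z]) (auto intro!: mult_nonneg_nonneg simp: less_imp_le)
qed

lemma mixture_le_G: "x \<in> space \<mm> \<Longrightarrow> mixture \<phi> k \<psi> x \<le> G x"
proof -
  assume x: "x \<in> space \<mm>"
  have "mixture \<phi> k \<psi> x \<le> (\<Sum>z=1..k. fst \<psi> z * G x)"
    unfolding mixture_def using x phi_le_G param_spaceD[OF psi] by (intro sum_mono mult_left_mono) auto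
  also have "\<dots> = G x" using param_space_sum[OF psi] by (simp flip: sum_distrib_right)
  finally show ?thesis .
qed

end

lemma mixture_continuous:
  assumes "x \<in> space \<mm>"
  shows "continuous_on (param_space T k) (\<lambda>\<psi>. mixture \<phi> k \<psi> x)"
proof -
  have fst: "continuous_on S (\<lambda>\<psi>::'d param. fst \<psi> z)" for S z
    by (rule continuous_on_compose2[OF continuous_on_product_coordinates continuous_on_fst]) auto
  have snd: "continuous_on S (\<lambda>\<psi>::'d param. snd \<psi> z)" for S z
    by (rule continuous_on_compose2[OF continuous_on_product_coordinates continuous_on_snd]) auto
  show ?thesis
    unfolding mixture_def using param_spaceD(3)
    by (intro continuous_on_sum continuous_on_mult fst continuous_on_compose2[OF phi_cont[OF assms] snd])
       blast
qed

section \<open>Upper brackets for the mixtures of a given order\<close>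

text \<open>Mixtures whose parameters agree up to \<open>1 / n\<close> in every coordinate differ by
  a multiple of \<open>G / n\<close>: \<open>G\<close> bounds \<open>\<phi>\<close>, which controls
  the change of weights, and it bounds \<open>L\<close>, which controls the change of atoms. The
  constants do not depend on \<open>n\<close>, so the net grows only polynomially.\<close>

lemma mixture_net:
  obtains B D C where "0 \<le> C" "\<forall>n\<ge>1. \<exists>P\<subseteq>param_space T k. finite P \<and> card P \<le> (2 * B * n + 1) ^ D \<and>
     (\<forall>\<psi>\<in>param_space T k. \<exists>p\<in>P. \<forall>x\<in>space \<mm>. mixture \<phi> k \<psi> x \<le> mixture \<phi> k p x + C / real n * G x)"
proof -
  \<comment> \<open>All real coordinates of a parameter under one index: \<open>(z, None)\<close> is
    the weight of component \<open>z\<close>, and \<open>(z, Some j)\<close> is coordinate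
    \<open>j\<close> of its atom.\<close>
  define I :: "(nat \<times> 'd option) set" where "I = {1..k} \<times> UNIV"
  define c where "c \<psi> i = (case snd i of None \<Rightarrow> fst \<psi> (fst i) | Some j \<Rightarrow> snd \<psi> (fst i) $ j)"
    for \<psi> :: "'d param" and i
  \<comment> \<open>Each of the \<open>k\<close> components costs 1 for its weight and
    \<open>CARD('d)\<close> for the \<open>norm1\<close> distance of its atoms, in units of
    \<open>G / n\<close>.\<close>
  define C where "C = real k * (real CARD('d) + 1)"
  obtain b where b: "\<And>\<theta>. \<theta> \<in> T \<Longrightarrow> norm \<theta> \<le> b"
    using compact_imp_bounded[OF T_compact] by (auto simp: bounded_iff)
  \<comment> \<open>The 1 bounds the weights and \<open>b\<close> bounds the atoms.\<close>
  define B where "B = nat \<lceil>max 1 b\<rceil>"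
  have B: "1 \<le> real B" "b \<le> real B" unfolding B_def by linarith+
  have bound: "\<bar>c \<psi> i\<bar> \<le> real B" if "\<psi> \<in> param_space T k" "i \<in> I" for \<psi> i
  proof (cases "snd i")
    case None
    then show ?thesis using param_spaceD(1,2)[OF that(1), of "fst i"] that(2) B
      by (auto simp: c_def I_def)
  next
    case (Some j)
    then show ?thesis
      using param_spaceD(3)[OF that(1), of "fst i"] that(2) B b
        component_le_norm_cart[of "snd \<psi> (fst i)" j]
      by (fastforce simp: c_def I_def)
  qed
  have key: "mixture \<phi> k \<psi> x \<le> mixture \<phi> k p x + C / real n * G x"
    if \<psi>: "\<psi> \<in> param_space T k" and p: "p \<in> param_space T k" and x: "x \<in> space \<mm>" and n: "n \<ge> 1"
      and close: "\<And>i. i \<in> I \<Longrightarrow> \<bar>c \<psi> i - c p i\<bar> \<le> 1 / real n" for \<psi> p x n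
  proof -
    have "fst \<psi> z * \<phi> x (snd \<psi> z) - fst p z * \<phi> x (snd p z) \<le> (real CARD('d) + 1) / real n * G x"
      if z: "z \<in> {1..k}" for z
    proof -
      note D = param_spaceD[OF \<psi> z] param_spaceD[OF p z]
      have w: "\<bar>fst \<psi> z - fst p z\<bar> \<le> 1 / real n"
        using close[of "(z, None)"] z by (simp add: I_def c_def)
      have "norm1 (snd \<psi> z - snd p z) \<le> (\<Sum>j\<in>(UNIV::'d set). 1 / real n)"
        unfolding norm1_def
      proof (intro sum_mono)
        fix j show "\<bar>(snd \<psi> z - snd p z) $ j\<bar> \<le> 1 / real n"
          using close[of "(z, Some j)"] z by (simp add: I_def c_def)
      qed
      then have s: "norm1 (snd \<psi> z - snd p z) \<le> real CARD('d) / real n" by simp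
      have "\<bar>\<phi> x (snd \<psi> z) - \<phi> x (snd p z)\<bar> \<le> L x * norm1 (snd \<psi> z - snd p z)"
        using phi_Lipschitz[OF x] D by auto
      also have "\<dots> \<le> G x * (real CARD('d) / real n)"
        using s L_le_G[OF x] L_nonneg[OF x]
        by (intro mult_mono) (auto simp: norm1_def sum_nonneg)
      finally have a: "\<bar>\<phi> x (snd \<psi> z) - \<phi> x (snd p z)\<bar> \<le> G x * (real CARD('d) / real n)" .
      \<comment> \<open>Change the atom first, keeping the weight of \<open>\<psi>\<close>, and then
        the weight, keeping the atom of \<open>p\<close>.\<close>
      have "fst \<psi> z * \<phi> x (snd \<psi> z) - fst p z * \<phi> x (snd p z) =
          fst \<psi> z * (\<phi> x (snd \<psi> z) - \<phi> x (snd p z)) + (fst \<psi> z - fst p z) * \<phi> x (snd p z)"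
        by (simp add: algebra_simps)
      also have "\<dots> \<le> 1 * (G x * (real CARD('d) / real n)) + 1 / real n * G x"
      proof (rule add_mono)
        have "fst \<psi> z * (\<phi> x (snd \<psi> z) - \<phi> x (snd p z)) \<le> fst \<psi> z * (G x * (real CARD('d) / real n))"
          using a D by (intro mult_left_mono) auto
        also have "\<dots> \<le> 1 * (G x * (real CARD('d) / real n))"
          using D G_pos[OF x] by (intro mult_right_mono) auto
        finally show "fst \<psi> z * (\<phi> x (snd \<psi> z) - \<phi> x (snd p z)) \<le> 1 * (G x * (real CARD('d) / real n))" .
        have "(fst \<psi> z - fst p z) * \<phi> x (snd p z) \<le> 1 / real n * \<phi> x (snd p z)"
          using w phi_pos[OF x D(6)] by (intro mult_right_mono) auto
        also have "\<dots> \<le> 1 / real n * G x"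
          using phi_le_G[OF x D(6)] by (intro mult_left_mono) auto
        finally show "(fst \<psi> z - fst p z) * \<phi> x (snd p z) \<le> 1 / real n * G x" .
      qed
      also have "\<dots> = (real CARD('d) + 1) / real n * G x"
        using n by (simp add: field_simps)
      finally show ?thesis .
    qed
    then have "(\<Sum>z=1..k. fst \<psi> z * \<phi> x (snd \<psi> z) - fst p z * \<phi> x (snd p z)) \<le>
        (\<Sum>z=1..k. (real CARD('d) + 1) / real n * G x)"
      by (intro sum_mono)
    then show ?thesis by (simp add: mixture_def sum_subtractf C_def)
  qed
  have "\<exists>P\<subseteq>param_space T k. finite P \<and> card P \<le> (2 * B * n + 1) ^ card I \<and>
     (\<forall>\<psi>\<in>param_space T k. \<exists>p\<in>P. \<forall>x\<in>space \<mm>. mixture \<phi> k \<psi> x \<le> mixture \<phi> k p x + C / real n * G x)"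
    if n: "n \<ge> 1" for n
  proof -
    have "\<exists>P\<subseteq>param_space T k. finite P \<and> card P \<le> (2 * B * n + 1) ^ card I \<and>
        (\<forall>\<psi>\<in>param_space T k. \<exists>p\<in>P. \<forall>i\<in>I. \<bar>c \<psi> i - c p i\<bar> \<le> 1 / real n)"
      by (rule finite_coordinate_net[OF _ n bound]) (simp_all add: I_def)
    then obtain P where P: "P \<subseteq> param_space T k" "finite P" "card P \<le> (2 * B * n + 1) ^ card I"
      and near: "\<forall>\<psi>\<in>param_space T k. \<exists>p\<in>P. \<forall>i\<in>I. \<bar>c \<psi> i - c p i\<bar> \<le> 1 / real n"
      by blast
    have "\<exists>p\<in>P. \<forall>x\<in>space \<mm>. mixture \<phi> k \<psi> x \<le> mixture \<phi> k p x + C / real n * G x"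
      if \<psi>: "\<psi> \<in> param_space T k" for \<psi>
    proof -
      obtain p where p: "p \<in> P" "\<forall>i\<in>I. \<bar>c \<psi> i - c p i\<bar> \<le> 1 / real n"
        using bspec[OF near \<psi>] by (elim bexE)
      show ?thesis
        by (intro bexI[OF _ p(1)] ballI key[OF \<psi> subsetD[OF P(1) p(1)] _ n p(2)[rule_format]])
    qed
    with P show ?thesis by blast
  qed
  moreover have "0 \<le> C" by (simp add: C_def)
  ultimately show ?thesis by (intro that allI impI)
qed

section \<open>Tail bounds for likelihood ratios\<close>

text \<open>Markov's inequality for the product: by independence its expectation is the product of
  the one-observation expectations, each of them the integral of \<open>h * g\<close> because
  \<open>g\<close> is the sampling density.\<close>

lemma prod_tail_bound:
  assumes h: "h \<in> borel_measurable \<mm>" "\<And>x. x \<in> space \<mm> \<Longrightarrow> 0 \<le> h x"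
    and int: "integrable \<mm> (\<lambda>x. h x * g x)" "(\<integral>x. h x * g x \<partial>\<mm>) \<le> s" and a: "0 < a"
  shows "{\<omega> \<in> space M. a \<le> (\<Prod>i=1..n. h (Xs i \<omega>))} \<in> events" (is "?A \<in> _")
    and "prob {\<omega> \<in> space M. a \<le> (\<Prod>i=1..n. h (Xs i \<omega>))} \<le> s ^ n / a"
proof -
  have hX: "(\<lambda>\<omega>. h (Xs i \<omega>)) \<in> borel_measurable M" if "1 \<le> i" for i
    using measurable_compose[OF Xs_meas[OF that] h(1)] .
  have pm: "(\<lambda>\<omega>. \<Prod>i=1..n. h (Xs i \<omega>)) \<in> borel_measurable M"
    using hX by (intro borel_measurable_prod) auto
  then show A: "?A \<in> events" by measurable
  have s: "0 \<le> s"
    using int(2) h(2) mixture_pos[OF psi0]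
    by (intro order_trans[OF integral_nonneg_AE int(2)] AE_I2 mult_nonneg_nonneg) (auto simp: less_imp_le)
  \<comment> \<open>With values in \<open>ennreal\<close> the expectation of the product factors
    before it is known to be finite.\<close>
  define H where "H i \<omega> = ennreal (h (Xs i \<omega>))" for i \<omega>
  have "indep_vars (\<lambda>_. borel) H {1..n}"
    unfolding H_def
    by (rule indep_vars_compose2[OF indep_vars_subset[OF indep]]) (use h in auto)
  then have "(\<integral>\<^sup>+\<omega>. (\<Prod>i=1..n. H i \<omega>) \<partial>M) = (\<Prod>i=1..n. \<integral>\<^sup>+\<omega>. H i \<omega> \<partial>M)"
    by (intro indep_vars_nn_integral) auto
  also have "\<dots> \<le> (\<Prod>i=1..n. ennreal s)"
  proof (intro prod_mono_ennreal)
    fix i assume i: "i \<in> {1..n}"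
    have "(\<integral>\<^sup>+\<omega>. H i \<omega> \<partial>M) = (\<integral>\<^sup>+x. ennreal (h x) \<partial>distr M \<mm> (Xs i))"
      unfolding H_def using i h Xs_meas by (subst nn_integral_distr) auto
    also have "\<dots> = (\<integral>\<^sup>+x. ennreal (g x) * ennreal (h x) \<partial>\<mm>)"
      using i h mixture_meas[OF psi0] by (subst law) (auto simp: nn_integral_density)
    also have "\<dots> = (\<integral>\<^sup>+x. ennreal (h x * g x) \<partial>\<mm>)"
      using h mixture_pos[OF psi0]
      by (intro nn_integral_cong) (auto simp: ennreal_mult' mult.commute less_imp_le)
    also have "\<dots> = ennreal (\<integral>x. h x * g x \<partial>\<mm>)"
      using int h mixture_pos[OF psi0]
      by (intro nn_integral_eq_integral) (auto intro!: AE_I2 mult_nonneg_nonneg simp: less_imp_le)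
    also have "\<dots> \<le> ennreal s" using int(2) by (rule ennreal_leI)
    finally show "(\<integral>\<^sup>+\<omega>. H i \<omega> \<partial>M) \<le> ennreal s" .
  qed
  also have "\<dots> = ennreal (s ^ n)" using s by (simp add: ennreal_power)
  finally have E: "(\<integral>\<^sup>+\<omega>. (\<Prod>i=1..n. H i \<omega>) \<partial>M) \<le> ennreal (s ^ n)" .
  have H: "(\<Prod>i=1..n. H i \<omega>) = ennreal (\<Prod>i=1..n. h (Xs i \<omega>))" if "\<omega> \<in> space M" for \<omega>
    unfolding H_def using that h Xs_space by (intro prod_ennreal) auto
  \<comment> \<open>The event is rescaled by \<open>1 / a\<close> to fit the form of Markov's
    inequality that compares with 1.\<close>
  have "emeasure M ?A \<le> emeasure M {\<omega> \<in> space M. 1 \<le> ennreal (1 / a) * (\<Prod>i=1..n. H i \<omega>)}"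
  proof (rule emeasure_mono)
    show "?A \<subseteq> {\<omega> \<in> space M. 1 \<le> ennreal (1 / a) * (\<Prod>i=1..n. H i \<omega>)}"
    proof safe
      fix \<omega> assume \<omega>: "\<omega> \<in> space M" "a \<le> (\<Prod>i=1..n. h (Xs i \<omega>))"
      then have "1 \<le> 1 / a * (\<Prod>i=1..n. h (Xs i \<omega>))" using a by (simp add: field_simps)
      then have "ennreal 1 \<le> ennreal (1 / a * (\<Prod>i=1..n. h (Xs i \<omega>)))" by (rule ennreal_leI)
      also have "\<dots> = ennreal (1 / a) * (\<Prod>i=1..n. H i \<omega>)"
        unfolding H[OF \<omega>(1)] using a by (intro ennreal_mult') simp
      finally show "1 \<le> ennreal (1 / a) * (\<Prod>i=1..n. H i \<omega>)" by simp
    qed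
    have "(\<lambda>\<omega>. \<Prod>i=1..n. H i \<omega>) \<in> borel_measurable M"
      unfolding H_def using hX by (intro borel_measurable_prod_ennreal) auto
    then show "{\<omega> \<in> space M. 1 \<le> ennreal (1 / a) * (\<Prod>i=1..n. H i \<omega>)} \<in> sets M" by measurable
  qed
  also have "\<dots> \<le> ennreal (1 / a) * (\<integral>\<^sup>+\<omega>. (\<Prod>i=1..n. H i \<omega>) * indicator (space M) \<omega> \<partial>M)"
    unfolding H_def using hX
    by (intro nn_integral_Markov_inequality borel_measurable_times_ennreal borel_measurable_prod_ennreal) auto
  also have "(\<integral>\<^sup>+\<omega>. (\<Prod>i=1..n. H i \<omega>) * indicator (space M) \<omega> \<partial>M) = (\<integral>\<^sup>+\<omega>. (\<Prod>i=1..n. H i \<omega>) \<partial>M)"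
    by (intro nn_integral_cong) auto
  also have "ennreal (1 / a) * \<dots> \<le> ennreal (1 / a) * ennreal (s ^ n)"
    by (intro mult_left_mono E) auto
  also have "\<dots> = ennreal (s ^ n / a)" using s a by (simp flip: ennreal_mult')
  finally show "prob ?A \<le> s ^ n / a"
    using s a by (simp add: emeasure_eq_measure)
qed

text \<open>A union bound over the net makes the estimate uniform: outside one event all bracket
  products stay below \<open>a\<close>, and each mixture inherits the bound from a bracket above it.
  Both exponents used later, 1 and 1/2, are instances of \<open>\<alpha>\<close>.\<close>

lemma log_ratio_tail_bound:
  assumes P: "P \<subseteq> param_space T k" "finite P" and c: "0 \<le> c" and \<alpha>: "0 < \<alpha>" and a: "0 < a"
    and net: "\<And>\<psi>. \<psi> \<in> param_space T k \<Longrightarrow> \<exists>p\<in>P. \<forall>x\<in>space \<mm>. mixture \<phi> k \<psi> x \<le> mixture \<phi> k p x + c * G x"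
    and int: "\<And>p. p \<in> P \<Longrightarrow> integrable \<mm> (\<lambda>x. ((mixture \<phi> k p x + c * G x) / g x) powr \<alpha> * g x)"
      "\<And>p. p \<in> P \<Longrightarrow> (\<integral>x. ((mixture \<phi> k p x + c * G x) / g x) powr \<alpha> * g x \<partial>\<mm>) \<le> s"
  shows "\<exists>E\<in>events. prob E \<le> real (card P) * (s ^ n / a) \<and>
    (\<forall>\<omega>\<in>space M - E. \<forall>\<psi>\<in>param_space T k.
      \<alpha> * (\<Sum>i=1..n. ln (mixture \<phi> k \<psi> (Xs i \<omega>)) - ln (g (Xs i \<omega>))) < ln a)"
proof -
  define h where "h p x = ((mixture \<phi> k p x + c * G x) / g x) powr \<alpha>" for p x
  define A where "A p = {\<omega> \<in> space M. a \<le> (\<Prod>i=1..n. h p (Xs i \<omega>))}" for p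
  have hm: "h p \<in> borel_measurable \<mm>" if "p \<in> P" for p
    using mixture_meas[OF subsetD[OF P(1) that]] mixture_meas[OF psi0] G_integrable
    unfolding h_def by measurable
  have A: "A p \<in> events" "prob (A p) \<le> s ^ n / a" if p: "p \<in> P" for p
    unfolding A_def
    by (rule prod_tail_bound[OF hm[OF p] _ int[OF p, folded h_def] a]; simp add: h_def)+
  have "prob (\<Union>p\<in>P. A p) \<le> (\<Sum>p\<in>P. prob (A p))"
    using A P by (intro finite_measure_subadditive_finite) auto
  also have "\<dots> \<le> real (card P) * (s ^ n / a)"
    using A(2) by (rule sum_bounded_above)
  finally have prob: "prob (\<Union>p\<in>P. A p) \<le> real (card P) * (s ^ n / a)" .
  show ?thesis
  proof (intro bexI[of _ "\<Union>p\<in>P. A p"] conjI prob ballI)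
    fix \<omega> \<psi> assume \<omega>: "\<omega> \<in> space M - (\<Union>p\<in>P. A p)" and \<psi>: "\<psi> \<in> param_space T k"
    obtain p where p: "p \<in> P" "\<And>x. x \<in> space \<mm> \<Longrightarrow> mixture \<phi> k \<psi> x \<le> mixture \<phi> k p x + c * G x"
      using net[OF \<psi>] by blast
    \<comment> \<open>Exponentiation turns the scaled log-ratio into a product that can be compared
      factor by factor with the bracket, since \<open>powr \<alpha>\<close> is monotone.\<close>
    have "exp (\<alpha> * (\<Sum>i=1..n. ln (mixture \<phi> k \<psi> (Xs i \<omega>)) - ln (g (Xs i \<omega>)))) =
        (\<Prod>i=1..n. exp (\<alpha> * (ln (mixture \<phi> k \<psi> (Xs i \<omega>)) - ln (g (Xs i \<omega>)))))"
      by (simp add: exp_sum sum_distrib_left)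
    also have "\<dots> \<le> (\<Prod>i=1..n. h p (Xs i \<omega>))"
    proof (intro prod_mono conjI)
      fix i assume "i \<in> {1..n}"
      then have x: "Xs i \<omega> \<in> space \<mm>" using Xs_space \<omega> by auto
      have "exp (\<alpha> * (ln (mixture \<phi> k \<psi> (Xs i \<omega>)) - ln (g (Xs i \<omega>)))) =
          (mixture \<phi> k \<psi> (Xs i \<omega>) / g (Xs i \<omega>)) powr \<alpha>"
        using mixture_pos[OF \<psi> x] mixture_pos[OF psi0 x] by (simp add: powr_def ln_div)
      also have "\<dots> \<le> h p (Xs i \<omega>)"
        unfolding h_def using mixture_pos[OF \<psi> x] mixture_pos[OF psi0 x] p(2)[OF x] \<alpha>
        by (intro powr_mono2 divide_right_mono) auto
      finally show "exp (\<alpha> * (ln (mixture \<phi> k \<psi> (Xs i \<omega>)) - ln (g (Xs i \<omega>)))) \<le> h p (Xs i \<omega>)" .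
    qed simp
    also have "\<dots> < a" using \<omega> p(1) by (auto simp: A_def not_le)
    also have "a = exp (ln a)" using a by simp
    finally show "\<alpha> * (\<Sum>i=1..n. ln (mixture \<phi> k \<psi> (Xs i \<omega>)) - ln (g (Xs i \<omega>))) < ln a"
      by simp
  qed (use A P in auto)
qed

section \<open>Logarithmic bound on the likelihood gain\<close>

text \<open>The threshold is one power of \<open>n\<close> above the size of the net, so the union
  bound leaves a probability of order \<open>1 / n\<close>, while the logarithm of the threshold is
  only a multiple of \<open>ln n\<close>.\<close>

lemma no_overfitting:
  "\<exists>D::nat. \<exists>E. (\<forall>n. E n \<in> events) \<and> (\<lambda>n. prob (E n)) \<longlonglongrightarrow> 0 \<and>
    (\<forall>n\<ge>1. \<forall>\<omega>\<in>space M - E n. \<forall>\<psi>\<in>param_space T k.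
      (\<Sum>i=1..n. ln (mixture \<phi> k \<psi> (Xs i \<omega>)) - ln (g (Xs i \<omega>))) < real D * ln (real n))"
proof -
  obtain B D C where C: "0 \<le> C" and net: "\<forall>n\<ge>1. \<exists>P\<subseteq>param_space T k. finite P \<and>
      card P \<le> (2 * B * n + 1) ^ D \<and> (\<forall>\<psi>\<in>param_space T k. \<exists>p\<in>P. \<forall>x\<in>space \<mm>.
        mixture \<phi> k \<psi> x \<le> mixture \<phi> k p x + C / real n * G x)"
    by (rule mixture_net[of k])
  define J where "J = (\<integral>x. G x \<partial>\<mm>)"
  have J: "0 \<le> J" unfolding J_def using G_pos by (intro integral_nonneg_AE AE_I2) (auto simp: less_imp_le)
  \<comment> \<open>The first factor bounds the size of the net relative to \<open>n ^ D\<close>,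
    the second bounds \<open>s ^ n\<close> uniformly in \<open>n\<close>.\<close>
  define K where "K = real (2 * B + 1) ^ D * exp (C * J)"
  have "\<forall>n. \<exists>E. E \<in> events \<and> (1 \<le> n \<longrightarrow> prob E \<le> K / real n \<and>
      (\<forall>\<omega>\<in>space M - E. \<forall>\<psi>\<in>param_space T k.
        (\<Sum>i=1..n. ln (mixture \<phi> k \<psi> (Xs i \<omega>)) - ln (g (Xs i \<omega>))) < real (Suc D) * ln (real n)))"
    (is "\<forall>n. \<exists>E. ?Q n E")
  proof
    fix n show "\<exists>E. ?Q n E"
    proof (cases "1 \<le> n")
      case n: True
      obtain P where P: "P \<subseteq> param_space T k" "finite P" "card P \<le> (2 * B * n + 1) ^ D"
        "\<forall>\<psi>\<in>param_space T k. \<exists>p\<in>P. \<forall>x\<in>space \<mm>.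
          mixture \<phi> k \<psi> x \<le> mixture \<phi> k p x + C / real n * G x"
        using spec[OF net, of n] n by blast
      define s where "s = 1 + C / real n * J"
      \<comment> \<open>At exponent 1 the density \<open>g\<close> cancels, so the integral is just
        the total mass of the bracket.\<close>
      have eq: "((mixture \<phi> k p x + C / real n * G x) / g x) powr 1 * g x =
          mixture \<phi> k p x + C / real n * G x" if "p \<in> P" "x \<in> space \<mm>" for p x
        using mixture_pos[OF psi0 that(2)] mixture_pos[OF subsetD[OF P(1) that(1)] that(2)] G_pos[OF that(2)] C
        by (simp add: add_nonneg_nonneg less_imp_le)
      have int: "integrable \<mm> (\<lambda>x. mixture \<phi> k p x + C / real n * G x)"
          "(\<integral>x. mixture \<phi> k p x + C / real n * G x \<partial>\<mm>) \<le> s" if "p \<in> P" for p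
        using mixture_integrable[OF subsetD[OF P(1) that]] mixture_integral[OF subsetD[OF P(1) that]] G_integrable
        by (auto simp: s_def J_def)
      have int': "integrable \<mm> (\<lambda>x. ((mixture \<phi> k p x + C / real n * G x) / g x) powr 1 * g x)"
          "(\<integral>x. ((mixture \<phi> k p x + C / real n * G x) / g x) powr 1 * g x \<partial>\<mm>) \<le> s" if "p \<in> P" for p
        using int[OF that] Bochner_Integration.integrable_cong[of \<mm> \<mm>, OF refl eq[OF that]]
          Bochner_Integration.integral_cong[of \<mm> \<mm>, OF refl eq[OF that]] by simp_all
      have "\<exists>E\<in>events. prob E \<le> real (card P) * (s ^ n / real n ^ Suc D) \<and>
        (\<forall>\<omega>\<in>space M - E. \<forall>\<psi>\<in>param_space T k.
          1 * (\<Sum>i=1..n. ln (mixture \<phi> k \<psi> (Xs i \<omega>)) - ln (g (Xs i \<omega>))) < ln (real n ^ Suc D))"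
        by (rule log_ratio_tail_bound[OF P(1,2) _ _ _ bspec[OF P(4)] int']) (use C n in auto)
      then obtain E where E: "E \<in> events" "prob E \<le> real (card P) * (s ^ n / real n ^ Suc D)"
        "\<forall>\<omega>\<in>space M - E. \<forall>\<psi>\<in>param_space T k.
          (\<Sum>i=1..n. ln (mixture \<phi> k \<psi> (Xs i \<omega>)) - ln (g (Xs i \<omega>))) < real (Suc D) * ln (real n)"
        unfolding mult_1 ln_realpow by blast
      \<comment> \<open>By \<open>1 + t \<le> exp t\<close>, the excess mass of order
        \<open>1 / n\<close> stays bounded after \<open>n\<close> factors.\<close>
      have "s ^ n \<le> exp (C / real n * J) ^ n"
        unfolding s_def using C J by (intro power_mono) (auto simp: exp_ge_add_one_self)
      also have "\<dots> = exp (C * J)" using n by (simp flip: exp_of_nat_mult)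
      finally have s: "s ^ n \<le> exp (C * J)" .
      have "real (card P) \<le> real ((2 * B * n + 1) ^ D)" using P(3) by (simp only: of_nat_le_iff)
      also have "\<dots> \<le> real (((2 * B + 1) * n) ^ D)"
        using n by (simp only: of_nat_le_iff) (intro power_mono, auto)
      also have "\<dots> = real (2 * B + 1) ^ D * real n ^ D" by (simp only: of_nat_power of_nat_mult power_mult_distrib)
      finally have "real (card P) * (s ^ n / real n ^ Suc D) \<le>
          (real (2 * B + 1) ^ D * real n ^ D) * (exp (C * J) / real n ^ Suc D)"
        using s C J by (intro mult_mono divide_right_mono) (auto simp: s_def)
      also have "\<dots> = K / real n" using n by (simp add: K_def field_simps)
      finally have "prob E \<le> K / real n" using E(2) by (rule order_trans[rotated])
      then have "?Q n E" using E(1,3) by (intro conjI impI)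
      then show ?thesis by (rule exI)
    next
      case False
      \<comment> \<open>At \<open>n = 0\<close> there is no mesh \<open>1 / n\<close>; the empty set
        only makes the sequence of events total.\<close>
      then have "?Q n {}" by simp
      then show ?thesis by (rule exI)
    qed
  qed
  from choice[OF this] obtain E where E: "\<forall>n. ?Q n (E n)" by (elim exE)
  have "(\<lambda>n. prob (E n)) \<longlonglongrightarrow> 0"
    by (rule tendsto_sandwich[OF _ _ tendsto_const lim_const_over_n[of K]])
       (use E in \<open>auto intro!: eventually_sequentiallyI[of 1]\<close>)
  then show ?thesis
    by (intro exI[of _ "Suc D"] exI[of _ E] conjI) (use E in auto)
qed

section \<open>Hellinger affinity and the linear loss of underfitted models\<close>

lemma sqrt_mult_le_average: "0 \<le> a \<Longrightarrow> 0 \<le> b \<Longrightarrow> sqrt (a * b) \<le> (a + b) / 2"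
  using arith_geo_mean_sqrt by blast

text \<open>Identifies the integrand of the tail bound at \<open>\<alpha> = 1/2\<close> with that of
  the Hellinger affinity.\<close>

lemma powr_half_ratio:
  assumes "0 \<le> u" "0 < v"
  shows "(u / v) powr (1/2) * v = sqrt (u * v)"
proof -
  have "(u / v) powr (1/2) * v = sqrt u * (v / sqrt v)"
    using assms by (simp add: powr_half_sqrt real_sqrt_divide)
  then show ?thesis
    using assms by (simp only: real_div_sqrt real_sqrt_mult less_imp_le)
qed

text \<open>Domination by the arithmetic mean of \<open>u\<close> and \<open>g\<close>. The function
  \<open>u\<close> is arbitrary because mixtures, brackets and the envelope \<open>G\<close> all
  take its place.\<close>

lemma affinity_integrable:
  assumes "integrable \<mm> u" "\<And>x. x \<in> space \<mm> \<Longrightarrow> 0 \<le> u x"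
  shows "integrable \<mm> (\<lambda>x. sqrt (u x * g x))"
proof (rule Bochner_Integration.integrable_bound)
  show "integrable \<mm> (\<lambda>x. (u x + g x) / 2)" using assms mixture_integrable[OF psi0] by auto
  show "(\<lambda>x. sqrt (u x * g x)) \<in> borel_measurable \<mm>"
    using assms mixture_meas[OF psi0] by measurable
  show "AE x in \<mm>. norm (sqrt (u x * g x)) \<le> norm ((u x + g x) / 2)"
  proof (rule AE_I2)
    fix x assume x: "x \<in> space \<mm>"
    have "0 \<le> u x" "0 \<le> g x" using assms(2)[OF x] mixture_pos[OF psi0 x] by auto
    then show "norm (sqrt (u x * g x)) \<le> norm ((u x + g x) / 2)"
      using sqrt_mult_le_average[of "u x" "g x"] by (simp add: abs_mult)
  qed
qed

text \<open>Both densities have mass 1, so 1 minus the affinity is half the integral of the squared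
  difference of their square roots, which vanishes only if they agree almost everywhere.\<close>

lemma affinity_less_1:
  assumes \<psi>: "\<psi> \<in> param_space T k" and "\<not> (AE x in \<mm>. g x = mixture \<phi> k \<psi> x)"
  shows "(\<integral>x. sqrt (mixture \<phi> k \<psi> x * g x) \<partial>\<mm>) < 1"
proof -
  let ?f = "mixture \<phi> k \<psi>"
  let ?d = "\<lambda>x. (?f x + g x) / 2 - sqrt (?f x * g x)"
  have si: "integrable \<mm> (\<lambda>x. sqrt (?f x * g x))"
    using mixture_pos[OF \<psi>] by (intro affinity_integrable mixture_integrable[OF \<psi>]) (auto simp: less_imp_le)
  have ai: "integrable \<mm> (\<lambda>x. (?f x + g x) / 2)"
    using mixture_integrable[OF \<psi>] mixture_integrable[OF psi0] by auto
  have d: "integrable \<mm> ?d" using si ai by auto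
  have nonneg: "0 \<le> ?d x" if "x \<in> space \<mm>" for x
    using sqrt_mult_le_average[of "?f x" "g x"] mixture_pos[OF \<psi> that] mixture_pos[OF psi0 that] by simp
  have eq: "(\<integral>x. ?d x \<partial>\<mm>) = 1 - (\<integral>x. sqrt (?f x * g x) \<partial>\<mm>)"
    using si ai mixture_integrable[OF \<psi>] mixture_integrable[OF psi0]
      mixture_integral[OF \<psi>] mixture_integral[OF psi0] by simp
  have "(\<integral>x. ?d x \<partial>\<mm>) \<noteq> 0"
  proof
    assume "(\<integral>x. ?d x \<partial>\<mm>) = 0"
    then have "AE x in \<mm>. ?d x = 0"
      using integral_nonneg_eq_0_iff_AE[OF d] nonneg by auto
    then have "AE x in \<mm>. g x = ?f x"
    proof (rule AE_mp, intro AE_I2 impI)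
      fix x assume x: "x \<in> space \<mm>" and "?d x = 0"
      moreover have "?d x = (sqrt (?f x) - sqrt (g x))\<^sup>2 / 2"
        using mixture_pos[OF \<psi> x] mixture_pos[OF psi0 x]
        by (simp add: power2_diff real_sqrt_mult field_simps)
      ultimately show "g x = ?f x" by simp
    qed
    with assms show False by blast
  qed
  moreover have "0 \<le> (\<integral>x. ?d x \<partial>\<mm>)" using nonneg by (intro integral_nonneg_AE AE_I2)
  ultimately show ?thesis using eq by linarith
qed

text \<open>Dominated convergence along sequences of parameters, with \<open>(G + g) / 2\<close> as
  the dominating function.\<close>

lemma affinity_continuous:
  "continuous_on (param_space T k) (\<lambda>\<psi>. \<integral>x. sqrt (mixture \<phi> k \<psi> x * g x) \<partial>\<mm>)"
  unfolding continuous_on_sequentially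
proof (intro ballI allI impI, elim conjE)
  fix u \<psi> assume \<psi>: "\<psi> \<in> param_space T k" and u: "\<forall>n. u n \<in> param_space T k" "u \<longlonglongrightarrow> \<psi>"
  have "(\<lambda>n. \<integral>x. sqrt (mixture \<phi> k (u n) x * g x) \<partial>\<mm>) \<longlonglongrightarrow> (\<integral>x. sqrt (mixture \<phi> k \<psi> x * g x) \<partial>\<mm>)"
  proof (rule integral_dominated_convergence)
    show "(\<lambda>x. sqrt (mixture \<phi> k \<psi> x * g x)) \<in> borel_measurable \<mm>"
      using mixture_meas[OF \<psi>] mixture_meas[OF psi0] by measurable
    show "(\<lambda>x. sqrt (mixture \<phi> k (u n) x * g x)) \<in> borel_measurable \<mm>" for n
      using mixture_meas[OF u(1)[rule_format]] mixture_meas[OF psi0] by measurable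
    show "integrable \<mm> (\<lambda>x. (G x + g x) / 2)" using G_integrable mixture_integrable[OF psi0] by auto
    show "AE x in \<mm>. (\<lambda>n. sqrt (mixture \<phi> k (u n) x * g x)) \<longlonglongrightarrow> sqrt (mixture \<phi> k \<psi> x * g x)"
    proof (intro AE_I2 tendsto_intros)
      fix x assume "x \<in> space \<mm>"
      from mixture_continuous[OF this, of k] \<psi> u
      show "(\<lambda>n. mixture \<phi> k (u n) x) \<longlonglongrightarrow> mixture \<phi> k \<psi> x"
        unfolding continuous_on_sequentially by (auto simp: o_def)
    qed
    show "AE x in \<mm>. norm (sqrt (mixture \<phi> k (u n) x * g x)) \<le> (G x + g x) / 2" for n
    proof (rule AE_I2)
      fix x assume x: "x \<in> space \<mm>"
      note un = u(1)[rule_format, of n]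
      show "norm (sqrt (mixture \<phi> k (u n) x * g x)) \<le> (G x + g x) / 2"
        using sqrt_mult_le_average[of "mixture \<phi> k (u n) x" "g x"] mixture_le_G[OF un x]
          mixture_pos[OF un x] mixture_pos[OF psi0 x] by (simp add: abs_mult)
    qed
  qed
  then show "((\<lambda>\<psi>. \<integral>x. sqrt (mixture \<phi> k \<psi> x * g x) \<partial>\<mm>) \<circ> u) \<longlonglongrightarrow> (\<integral>x. sqrt (mixture \<phi> k \<psi> x * g x) \<partial>\<mm>)"
    by (simp add: o_def)
qed

text \<open>By compactness the largest affinity is attained, and at the maximizer it is below 1
  because no mixture of order \<open>k\<close> reproduces \<open>g\<close>.\<close>

lemma affinity_bounded_away:
  assumes "1 \<le> k" "\<not> ae_member \<mm> g (mixture_class \<phi> T k)"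
  shows "\<exists>r<1. \<forall>\<psi>\<in>param_space T k. (\<integral>x. sqrt (mixture \<phi> k \<psi> x * g x) \<partial>\<mm>) \<le> r"
proof -
  have "\<exists>\<psi>\<in>param_space T k. \<forall>\<psi>'\<in>param_space T k.
      (\<integral>x. sqrt (mixture \<phi> k \<psi>' x * g x) \<partial>\<mm>) \<le> (\<integral>x. sqrt (mixture \<phi> k \<psi> x * g x) \<partial>\<mm>)"
    by (rule continuous_attains_sup[OF compact_param_space[OF T_compact]
        param_space_nonempty[OF assms(1) T_nonempty] affinity_continuous])
  then show ?thesis
    using affinity_less_1 assms(2) unfolding ae_member_def mixture_class_def by blast
qed

text \<open>With a mesh independent of \<open>n\<close> the net has a fixed number of points, and
  every bracket has affinity at most some \<open>s < 1\<close>. Half of the exponential decay of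
  \<open>s ^ n\<close> pays for the probability, the other half for the bound on the
  log-ratio.\<close>

lemma no_underfitting:
  assumes k: "1 \<le> k" "\<not> ae_member \<mm> g (mixture_class \<phi> T k)"
  shows "\<exists>\<epsilon>>0. \<exists>E. (\<forall>n. E n \<in> events) \<and> (\<lambda>n. prob (E n)) \<longlonglongrightarrow> 0 \<and>
    (\<forall>n. \<forall>\<omega>\<in>space M - E n. \<forall>\<psi>\<in>param_space T k.
      (\<Sum>i=1..n. ln (mixture \<phi> k \<psi> (Xs i \<omega>)) - ln (g (Xs i \<omega>))) < - \<epsilon> * real n)"
proof -
  obtain r where r: "r < 1" "\<And>\<psi>. \<psi> \<in> param_space T k \<Longrightarrow> (\<integral>x. sqrt (mixture \<phi> k \<psi> x * g x) \<partial>\<mm>) \<le> r"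
    using affinity_bounded_away[OF k] by blast
  obtain B D C where C: "0 \<le> C" and net: "\<forall>n\<ge>1. \<exists>P\<subseteq>param_space T k. finite P \<and>
      card P \<le> (2 * B * n + 1) ^ D \<and> (\<forall>\<psi>\<in>param_space T k. \<exists>p\<in>P. \<forall>x\<in>space \<mm>.
        mixture \<phi> k \<psi> x \<le> mixture \<phi> k p x + C / real n * G x)"
    by (rule mixture_net[of k])
  have Gg: "integrable \<mm> (\<lambda>x. sqrt (G x * g x))"
    using G_integrable G_pos by (intro affinity_integrable) (auto simp: less_imp_le)
  define J where "J = (\<integral>x. sqrt (G x * g x) \<partial>\<mm>)"
  \<comment> \<open>Widening a mixture by \<open>c * G\<close> raises its affinity with
    \<open>g\<close> by at most \<open>sqrt c * J\<close>; a fine enough mesh keeps the total below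
    1.\<close>
  have "(\<lambda>N. max r 0 + sqrt (C / real N) * J) \<longlonglongrightarrow> max r 0 + sqrt 0 * J"
    by (intro tendsto_intros lim_const_over_n)
  then have "eventually (\<lambda>N. max r 0 + sqrt (C / real N) * J < 1) sequentially"
    by (rule order_tendstoD(2)) (use r(1) in auto)
  then obtain N0 where N0: "\<And>N. N0 \<le> N \<Longrightarrow> max r 0 + sqrt (C / real N) * J < 1"
    by (auto simp: eventually_sequentially)
  define N where "N = max N0 1"
  have N: "1 \<le> N" "max r 0 + sqrt (C / real N) * J < 1"
    using N0[of N] by (auto simp: N_def)
  define c where "c = C / real N"
  have c: "0 \<le> c" using C by (simp add: c_def)
  obtain P where P: "P \<subseteq> param_space T k" "finite P"
      "\<forall>\<psi>\<in>param_space T k. \<exists>p\<in>P. \<forall>x\<in>space \<mm>. mixture \<phi> k \<psi> x \<le> mixture \<phi> k p x + c * G x"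
    using spec[OF net, of N] N(1) unfolding c_def by blast
  \<comment> \<open>The floor 1/2 keeps \<open>s\<close> positive, so that \<open>ln s\<close> and
    division by \<open>sqrt s\<close> make sense, without reaching 1.\<close>
  define s where "s = max (max r 0 + sqrt c * J) (1/2)"
  have s: "0 < s" "s < 1" "r + sqrt c * J \<le> s" using N by (auto simp: s_def c_def)
  have eq: "((mixture \<phi> k p x + c * G x) / g x) powr (1/2) * g x =
      sqrt ((mixture \<phi> k p x + c * G x) * g x)" if "p \<in> P" "x \<in> space \<mm>" for p x
  proof -
    have u: "0 \<le> mixture \<phi> k p x + c * G x" "0 < g x"
      using mixture_pos[OF psi0 that(2)] mixture_pos[OF subsetD[OF P(1) that(1)] that(2)] G_pos[OF that(2)] c
      by (simp_all add: add_nonneg_nonneg less_imp_le)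
    then show ?thesis by (rule powr_half_ratio)
  qed
  have int: "integrable \<mm> (\<lambda>x. sqrt ((mixture \<phi> k p x + c * G x) * g x))" (is ?A)
      "(\<integral>x. sqrt ((mixture \<phi> k p x + c * G x) * g x) \<partial>\<mm>) \<le> s" (is ?B) if "p \<in> P" for p
  proof -
    have p: "p \<in> param_space T k" by (rule subsetD[OF P(1) that])
    have pos: "0 < mixture \<phi> k p x" "0 < g x" "0 < G x" if "x \<in> space \<mm>" for x
      using mixture_pos[OF p that] mixture_pos[OF psi0 that] G_pos[OF that] by auto
    show A: ?A using mixture_integrable[OF p] G_integrable pos c
      by (intro affinity_integrable) (auto intro!: add_nonneg_nonneg simp: less_imp_le)
    have fg: "integrable \<mm> (\<lambda>x. sqrt (mixture \<phi> k p x * g x))"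
      using mixture_integrable[OF p] pos by (intro affinity_integrable) (auto simp: less_imp_le)
    have "(\<integral>x. sqrt ((mixture \<phi> k p x + c * G x) * g x) \<partial>\<mm>) \<le>
        (\<integral>x. sqrt (mixture \<phi> k p x * g x) + sqrt c * sqrt (G x * g x) \<partial>\<mm>)"
    proof (rule integral_mono[OF A])
      fix x assume x: "x \<in> space \<mm>"
      have "sqrt ((mixture \<phi> k p x + c * G x) * g x) = sqrt (mixture \<phi> k p x * g x + c * (G x * g x))"
        by (simp add: algebra_simps)
      also have "\<dots> \<le> sqrt (mixture \<phi> k p x * g x) + sqrt (c * (G x * g x))"
        using pos[OF x] c by (intro sqrt_add_le_add_sqrt) auto
      finally show "sqrt ((mixture \<phi> k p x + c * G x) * g x) \<le>
          sqrt (mixture \<phi> k p x * g x) + sqrt c * sqrt (G x * g x)"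
        by (simp only: real_sqrt_mult[of c])
    qed (use fg Gg in auto)
    also have "\<dots> = (\<integral>x. sqrt (mixture \<phi> k p x * g x) \<partial>\<mm>) + sqrt c * J"
      using fg Gg by (simp add: J_def)
    also have "\<dots> \<le> s" using r(2)[OF p] s by linarith
    finally show ?B .
  qed
  have int': "integrable \<mm> (\<lambda>x. ((mixture \<phi> k p x + c * G x) / g x) powr (1/2) * g x)"
      "(\<integral>x. ((mixture \<phi> k p x + c * G x) / g x) powr (1/2) * g x \<partial>\<mm>) \<le> s" if "p \<in> P" for p
    using int[OF that] Bochner_Integration.integrable_cong[of \<mm> \<mm>, OF refl eq[OF that]]
      Bochner_Integration.integral_cong[of \<mm> \<mm>, OF refl eq[OF that]] by simp_all
  \<comment> \<open>The threshold \<open>sqrt s ^ n\<close> is the geometric mean of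
    \<open>s ^ n\<close> and 1: it leaves the probability bound \<open>sqrt s ^ n\<close>, and after
    division by 1/2 its logarithm is \<open>n * ln s\<close>.\<close>
  have "\<forall>n. \<exists>E. E \<in> events \<and> prob E \<le> real (card P) * (s ^ n / sqrt s ^ n) \<and>
    (\<forall>\<omega>\<in>space M - E. \<forall>\<psi>\<in>param_space T k.
      1/2 * (\<Sum>i=1..n. ln (mixture \<phi> k \<psi> (Xs i \<omega>)) - ln (g (Xs i \<omega>))) < ln (sqrt s ^ n))"
    unfolding Bex_def[symmetric]
    by (intro allI, rule log_ratio_tail_bound[OF P(1,2) c _ _ bspec[OF P(3)] int']) (use s in auto)
  from choice[OF this] obtain E where E: "\<forall>n. E n \<in> events \<and>
      prob (E n) \<le> real (card P) * (s ^ n / sqrt s ^ n) \<and>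
      (\<forall>\<omega>\<in>space M - E n. \<forall>\<psi>\<in>param_space T k.
        1/2 * (\<Sum>i=1..n. ln (mixture \<phi> k \<psi> (Xs i \<omega>)) - ln (g (Xs i \<omega>))) < ln (sqrt s ^ n))"
    by (elim exE)
  have ss: "s ^ n / sqrt s ^ n = sqrt s ^ n" for n
    using s by (simp add: real_div_sqrt flip: power_divide)
  have "(\<lambda>n. real (card P) * sqrt s ^ n) \<longlonglongrightarrow> real (card P) * 0"
    using s by (intro tendsto_intros LIMSEQ_power_zero) auto
  then have lim: "(\<lambda>n. real (card P) * sqrt s ^ n) \<longlonglongrightarrow> 0" by simp
  have "\<forall>n. prob (E n) \<le> real (card P) * sqrt s ^ n"
    using E by (simp only: ss simp_thms)
  then have null: "(\<lambda>n. prob (E n)) \<longlonglongrightarrow> 0"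
    by (intro tendsto_sandwich[OF _ _ tendsto_const lim]) auto
  have bound: "\<forall>n. \<forall>\<omega>\<in>space M - E n. \<forall>\<psi>\<in>param_space T k.
      (\<Sum>i=1..n. ln (mixture \<phi> k \<psi> (Xs i \<omega>)) - ln (g (Xs i \<omega>))) < - (- ln s) * real n"
  proof (intro allI ballI)
    fix n \<omega> \<psi> assume "\<omega> \<in> space M - E n" "\<psi> \<in> param_space T k"
    then have "1/2 * (\<Sum>i=1..n. ln (mixture \<phi> k \<psi> (Xs i \<omega>)) - ln (g (Xs i \<omega>))) < ln (sqrt s ^ n)"
      using E by blast
    also have "\<dots> = real n * (ln s / 2)" using s by (simp only: ln_realpow ln_sqrt)
    finally show "(\<Sum>i=1..n. ln (mixture \<phi> k \<psi> (Xs i \<omega>)) - ln (g (Xs i \<omega>))) < - (- ln s) * real n"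
      by (simp add: mult.commute)
  qed
  have pos: "0 < - ln s" using s by simp
  have events: "\<forall>n. E n \<in> events" using E by blast
  show ?thesis
    by (rule exI[of _ "- ln s"], rule conjI[OF pos], rule exI[of _ E],
        rule conjI[OF events conjI[OF null bound]])
qed

section \<open>Comparison of penalized criteria and consistency\<close>

text \<open>Mixtures are positive and continuous in the parameter, so compactness yields a
  minimizer; this gives the \<open>LEAST\<close> in the criterion its meaning as a true
  minimum.\<close>

lemma pen_criterion_attained:
  assumes k: "1 \<le> k" and \<omega>: "\<omega> \<in> space M"
  obtains \<psi> where "\<psi> \<in> param_space T k"
    "pen_criterion \<phi> T pen (\<lambda>i. Xs i \<omega>) n k = neg_loglik \<phi> (\<lambda>i. Xs i \<omega>) n k \<psi> + pen k n"
    "\<And>\<psi>'. \<psi>' \<in> param_space T k \<Longrightarrow>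
      pen_criterion \<phi> T pen (\<lambda>i. Xs i \<omega>) n k \<le> neg_loglik \<phi> (\<lambda>i. Xs i \<omega>) n k \<psi>' + pen k n"
proof -
  let ?l = "neg_loglik \<phi> (\<lambda>i. Xs i \<omega>) n k"
  have pos: "mixture \<phi> k \<psi> (Xs i \<omega>) \<noteq> 0" if "i \<in> {1..n}" "\<psi> \<in> param_space T k" for i \<psi>
    using mixture_pos[OF that(2) Xs_space[OF _ \<omega>], of i] that(1) by simp
  have "continuous_on (param_space T k) ?l"
    unfolding neg_loglik_def using pos
    by (intro continuous_intros mixture_continuous Xs_space \<omega>) auto
  from continuous_attains_inf[OF compact_param_space[OF T_compact]
      param_space_nonempty[OF k T_nonempty] this]
  obtain \<psi> where \<psi>: "\<psi> \<in> param_space T k" "\<forall>\<psi>'\<in>param_space T k. ?l \<psi> \<le> ?l \<psi>'"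
    by blast
  then have "(LEAST v. v \<in> ?l ` param_space T k) = ?l \<psi>"
    by (intro Least_equality) auto
  with \<psi> show ?thesis
    by (intro that[of \<psi>]) (auto simp: pen_criterion_def)
qed

text \<open>The minimum at order \<open>k0\<close> is at most the value at the true parameter. The
  gain in fit of order \<open>k\<close> over that value is below \<open>b / n\<close>, hence below
  the difference of penalties. The bound \<open>b\<close> is negative for underfitting and
  logarithmic in \<open>n\<close> for overfitting.\<close>

lemma pen_criterion_less:
  assumes k: "1 \<le> k" and n: "1 \<le> n" and \<omega>: "\<omega> \<in> space M"
    and ratio: "\<And>\<psi>. \<psi> \<in> param_space T k \<Longrightarrow>
      (\<Sum>i=1..n. ln (mixture \<phi> k \<psi> (Xs i \<omega>)) - ln (g (Xs i \<omega>))) < b"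
    and b: "b / real n \<le> pen k n - pen k0 n"
  shows "pen_criterion \<phi> T pen (\<lambda>i. Xs i \<omega>) n k0 < pen_criterion \<phi> T pen (\<lambda>i. Xs i \<omega>) n k"
proof -
  let ?l = "neg_loglik \<phi> (\<lambda>i. Xs i \<omega>) n"
  obtain \<psi> where \<psi>: "\<psi> \<in> param_space T k"
    "pen_criterion \<phi> T pen (\<lambda>i. Xs i \<omega>) n k = ?l k \<psi> + pen k n"
    using pen_criterion_attained[OF k \<omega>] by metis
  have "pen_criterion \<phi> T pen (\<lambda>i. Xs i \<omega>) n k0 \<le> ?l k0 \<psi>0 + pen k0 n"
    using pen_criterion_attained[OF k0 \<omega>] psi0 by metis
  moreover have "?l k0 \<psi>0 - ?l k \<psi> =
      (\<Sum>i=1..n. ln (mixture \<phi> k \<psi> (Xs i \<omega>)) - ln (g (Xs i \<omega>))) / real n"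
    by (simp add: neg_loglik_def sum_subtractf diff_divide_distrib)
  moreover have "\<dots> < b / real n"
    using ratio[OF \<psi>(1)] n by (simp add: divide_strict_right_mono)
  ultimately show ?thesis using b \<psi>(2) by linarith
qed

lemma pen_criterion_separation:
  assumes k: "1 \<le> k" "k \<noteq> k0"
    and under: "k < k0 \<Longrightarrow> \<not> ae_member \<mm> g (mixture_class \<phi> T k)"
    and pen0: "pen k \<longlonglongrightarrow> 0" "pen k0 \<longlonglongrightarrow> 0"
    and pen_gap: "k0 < k \<Longrightarrow>
      filterlim (\<lambda>n. real n / ln (real n) * (pen k n - pen k0 n)) at_top sequentially"
  shows "\<exists>E. (\<forall>n. E n \<in> events) \<and> (\<lambda>n. prob (E n)) \<longlonglongrightarrow> 0 \<and>
    (\<forall>\<^sub>F n in sequentially. \<forall>\<omega>\<in>space M - E n.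
      pen_criterion \<phi> T pen (\<lambda>i. Xs i \<omega>) n k0 < pen_criterion \<phi> T pen (\<lambda>i. Xs i \<omega>) n k)"
proof (cases "k < k0")
  case True
  obtain \<epsilon> E where "0 < \<epsilon>" and E: "\<forall>n. E n \<in> events" "(\<lambda>n. prob (E n)) \<longlonglongrightarrow> 0"
    and ratio: "\<forall>n. \<forall>\<omega>\<in>space M - E n. \<forall>\<psi>\<in>param_space T k.
      (\<Sum>i=1..n. ln (mixture \<phi> k \<psi> (Xs i \<omega>)) - ln (g (Xs i \<omega>))) < - \<epsilon> * real n"
    using no_underfitting[OF k(1) under[OF True]] by (elim exE conjE)
  \<comment> \<open>Vanishing penalties cannot make up for a loss in fit of at least
    \<open>\<epsilon>\<close> per observation.\<close>
  have "(\<lambda>n. pen k n - pen k0 n) \<longlonglongrightarrow> 0 - 0" by (intro tendsto_diff pen0)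
  then have "\<forall>\<^sub>F n in sequentially. - \<epsilon> < pen k n - pen k0 n"
    by (rule order_tendstoD(1)) (use \<open>0 < \<epsilon>\<close> in simp)
  then have "\<forall>\<^sub>F n in sequentially. \<forall>\<omega>\<in>space M - E n.
      pen_criterion \<phi> T pen (\<lambda>i. Xs i \<omega>) n k0 < pen_criterion \<phi> T pen (\<lambda>i. Xs i \<omega>) n k"
    using eventually_ge_at_top[of 1]
  proof eventually_elim
    case (elim n)
    show ?case
    proof
      fix \<omega> assume \<omega>: "\<omega> \<in> space M - E n"
      show "pen_criterion \<phi> T pen (\<lambda>i. Xs i \<omega>) n k0 < pen_criterion \<phi> T pen (\<lambda>i. Xs i \<omega>) n k"
        by (rule pen_criterion_less[where pen = pen, OF k(1) elim(2) _ bspec[OF bspec[OF spec[OF ratio] \<omega>]]])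
           (use elim \<omega> in auto)
    qed
  qed
  with E show ?thesis by (intro exI[of _ E] conjI)
next
  case False
  then have "k0 < k" using k by simp
  obtain D :: nat and E where E: "\<forall>n. E n \<in> events" "(\<lambda>n. prob (E n)) \<longlonglongrightarrow> 0"
    and ratio: "\<forall>n\<ge>1. \<forall>\<omega>\<in>space M - E n. \<forall>\<psi>\<in>param_space T k.
      (\<Sum>i=1..n. ln (mixture \<phi> k \<psi> (Xs i \<omega>)) - ln (g (Xs i \<omega>))) < real D * ln (real n)"
    using no_overfitting[of k] by (elim exE conjE)
  have "\<forall>\<^sub>F n in sequentially. real D \<le> real n / ln (real n) * (pen k n - pen k0 n)"
    using pen_gap[OF \<open>k0 < k\<close>] by (simp add: filterlim_at_top)
  then have "\<forall>\<^sub>F n in sequentially. \<forall>\<omega>\<in>space M - E n.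
      pen_criterion \<phi> T pen (\<lambda>i. Xs i \<omega>) n k0 < pen_criterion \<phi> T pen (\<lambda>i. Xs i \<omega>) n k"
    \<comment> \<open>From \<open>n = 2\<close> on \<open>ln n\<close> is positive, so the penalty
      gap may be multiplied by \<open>ln n / n\<close>.\<close>
    using eventually_ge_at_top[of 2]
  proof eventually_elim
    case (elim n)
    have n: "1 \<le> n" using elim by simp
    have "0 < ln (real n)" using elim by simp
    with elim have gap: "real D * ln (real n) / real n \<le> pen k n - pen k0 n"
      by (simp add: field_simps)
    show ?case
    proof
      fix \<omega> assume \<omega>: "\<omega> \<in> space M - E n"
      show "pen_criterion \<phi> T pen (\<lambda>i. Xs i \<omega>) n k0 < pen_criterion \<phi> T pen (\<lambda>i. Xs i \<omega>) n k"
        by (rule pen_criterion_less[where pen = pen, OF k(1) n _ bspec[OF bspec[OF mp[OF spec[OF ratio] n] \<omega>]] gap])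
           (use \<omega> in auto)
    qed
  qed
  with E show ?thesis by (intro exI[of _ E] conjI)
qed

text \<open>Outside the union of the finitely many exceptional events, one per competitor,
  \<open>k0\<close> is eventually the strict minimizer; the probability of this union tends to
  0.\<close>

lemma order_estimator_consistent:
  assumes kbar: "k0 \<le> kbar"
    and under: "\<And>k. 1 \<le> k \<Longrightarrow> k < k0 \<Longrightarrow> \<not> ae_member \<mm> g (mixture_class \<phi> T k)"
    and pen0: "\<And>k. k \<in> {1..kbar} \<Longrightarrow> pen k \<longlonglongrightarrow> 0"
    and pen_gap: "\<And>k. k0 < k \<Longrightarrow> k \<le> kbar \<Longrightarrow>
      filterlim (\<lambda>n. real n / ln (real n) * (pen k n - pen k0 n)) at_top sequentially"
    and meas: "\<And>n. (\<lambda>\<omega>. order_estimator \<phi> T pen kbar (\<lambda>i. Xs i \<omega>) n) \<in> measurable M (count_space UNIV)"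
  shows "(\<lambda>n. prob {\<omega> \<in> space M. order_estimator \<phi> T pen kbar (\<lambda>i. Xs i \<omega>) n = k0}) \<longlonglongrightarrow> 1"
proof -
  define I where "I = {1..kbar} - {k0}"
  have fin: "finite I" by (simp add: I_def)
  define A where "A n = {\<omega> \<in> space M. order_estimator \<phi> T pen kbar (\<lambda>i. Xs i \<omega>) n = k0}" for n
  have "\<forall>k\<in>I. \<exists>E. (\<forall>n. E n \<in> events) \<and> (\<lambda>n. prob (E n)) \<longlonglongrightarrow> 0 \<and>
    (\<forall>\<^sub>F n in sequentially. \<forall>\<omega>\<in>space M - E n.
      pen_criterion \<phi> T pen (\<lambda>i. Xs i \<omega>) n k0 < pen_criterion \<phi> T pen (\<lambda>i. Xs i \<omega>) n k)"
    using kbar k0 by (intro ballI pen_criterion_separation under pen0 pen_gap) (auto simp: I_def)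
  from bchoice[OF this] obtain E where E: "\<And>k n. k \<in> I \<Longrightarrow> E k n \<in> events"
    "\<And>k. k \<in> I \<Longrightarrow> (\<lambda>n. prob (E k n)) \<longlonglongrightarrow> 0"
    "\<And>k. k \<in> I \<Longrightarrow> \<forall>\<^sub>F n in sequentially. \<forall>\<omega>\<in>space M - E k n.
      pen_criterion \<phi> T pen (\<lambda>i. Xs i \<omega>) n k0 < pen_criterion \<phi> T pen (\<lambda>i. Xs i \<omega>) n k"
    by auto
  have "\<forall>\<^sub>F n in sequentially. \<forall>k\<in>I. \<forall>\<omega>\<in>space M - E k n.
      pen_criterion \<phi> T pen (\<lambda>i. Xs i \<omega>) n k0 < pen_criterion \<phi> T pen (\<lambda>i. Xs i \<omega>) n k"
    by (rule eventually_ball_finite[OF fin ballI[OF E(3)]])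
  then have lower: "\<forall>\<^sub>F n in sequentially. 1 - (\<Sum>k\<in>I. prob (E k n)) \<le> prob (A n)"
  proof eventually_elim
    case (elim n)
    have sub: "space M - (\<Union>k\<in>I. E k n) \<subseteq> A n"
    proof
      fix \<omega> assume \<omega>: "\<omega> \<in> space M - (\<Union>k\<in>I. E k n)"
      then have "order_estimator \<phi> T pen kbar (\<lambda>i. Xs i \<omega>) n = k0"
        using elim kbar k0 by (intro order_estimator_eqI) (auto simp: I_def)
      with \<omega> show "\<omega> \<in> A n" by (simp add: A_def)
    qed
    have "A n \<in> events" unfolding A_def using meas[of n] by measurable
    have U: "(\<Union>k\<in>I. E k n) \<in> events" by (rule sets.finite_UN[OF fin E(1)])
    have "prob (\<Union>k\<in>I. E k n) \<le> (\<Sum>k\<in>I. prob (E k n))"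
      by (rule finite_measure_subadditive_finite[OF fin image_subsetI[OF E(1)]])
    then have "1 - (\<Sum>k\<in>I. prob (E k n)) \<le> prob (space M - (\<Union>k\<in>I. E k n))"
      using prob_compl[OF U] by simp
    also have "\<dots> \<le> prob (A n)" by (rule finite_measure_mono[OF sub \<open>A n \<in> events\<close>])
    finally show ?case .
  qed
  have "(\<lambda>n. 1 - (\<Sum>k\<in>I. prob (E k n))) \<longlonglongrightarrow> 1 - (\<Sum>k\<in>I. 0)"
    by (rule tendsto_diff[OF tendsto_const tendsto_sum[OF E(2)]])
  then have lim: "(\<lambda>n. 1 - (\<Sum>k\<in>I. prob (E k n))) \<longlonglongrightarrow> 1" by simp
  have "(\<lambda>n. prob (A n)) \<longlonglongrightarrow> 1"
    by (rule tendsto_sandwich[OF lower always_eventually lim tendsto_const]) simp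
  then show ?thesis by (simp only: A_def)
qed

end

section \<open>Passage from the given density to a mixture with the same law\<close>

theorem theorem8:
  fixes M :: "'w measure"
    and \<X> :: "'x::topological_space set"
    and \<mm> :: "'x measure"
    and X :: "'w \<Rightarrow> 'x"
    and f\<^sub>0 :: "'x \<Rightarrow> real"
    and T :: "(real ^ 'd) set"
    and \<phi> :: "'x \<Rightarrow> real ^ 'd \<Rightarrow> real"
    and kbar k\<^sub>0 :: nat
    and Xs :: "nat \<Rightarrow> 'w \<Rightarrow> 'x"
    and G\<^sub>1 G\<^sub>2 L :: "'x \<Rightarrow> real"
    and pen :: "nat \<Rightarrow> nat \<Rightarrow> real"
  assumes prob: "prob_space M"
    and sets_m: "sets \<mm> = sets (restrict_space borel \<X>)"
    and f0_pos: "\<forall>x\<in>\<X>. f\<^sub>0 x > 0"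
    and X_density: "distributed M \<mm> X (\<lambda>x. ennreal (f\<^sub>0 x))"
    and phi_density: "\<forall>\<theta>\<in>T. (\<integral>x. \<phi> x \<theta> \<partial>\<mm>) = 1"
    and A1_order: "k\<^sub>0 \<in> {1..kbar}"
      "ae_member \<mm> f\<^sub>0 (mixture_class \<phi> T k\<^sub>0)"
      "\<not> ae_member \<mm> f\<^sub>0 (mixture_class \<phi> T (k\<^sub>0 - 1))"
    and A1_iid: "prob_space.indep_vars M (\<lambda>_. \<mm>) Xs {1..}"
      "\<forall>i\<ge>1. distr M \<mm> (Xs i) = distr M \<mm> X"
    and A2: "\<forall>x\<in>\<X>. \<forall>\<theta>\<in>T. \<phi> x \<theta> > 0" "compact T"
    and A3: "\<forall>x\<in>\<X>. continuous_on T (\<phi> x)"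
      "\<forall>\<theta>\<in>T. (\<lambda>x. \<phi> x \<theta>) \<in> borel_measurable \<mm>"
    and A4: "integrable (distr M \<mm> X) G\<^sub>1"
      "\<forall>x\<in>\<X>. \<forall>\<theta>\<in>T. \<bar>ln (\<phi> x \<theta>)\<bar> < G\<^sub>1 x"
    and A5: "integrable \<mm> G\<^sub>2" "\<forall>x\<in>\<X>. L x \<ge> 0"
      "\<forall>x\<in>\<X>. \<forall>\<theta>\<^sub>1\<in>T. \<forall>\<theta>\<^sub>2\<in>T. \<bar>\<phi> x \<theta>\<^sub>1 - \<phi> x \<theta>\<^sub>2\<bar> \<le> L x * norm1 (\<theta>\<^sub>1 - \<theta>\<^sub>2)"
      "\<forall>x\<in>\<X>. \<forall>\<theta>\<in>T. \<phi> x \<theta> + L x \<le> G\<^sub>2 x"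
    and B1: "\<forall>k\<in>{1..kbar}. (\<lambda>n. pen k n) \<longlonglongrightarrow> 0"
    and B2: "\<forall>k l. 1 \<le> k \<and> k < l \<and> l \<le> kbar \<longrightarrow>
      filterlim (\<lambda>n. real n / ln (real n) * (pen l n - pen k n)) at_top sequentially"
    and estimator_measurable:
      "\<forall>n. (\<lambda>\<omega>. order_estimator \<phi> T pen kbar (\<lambda>i. Xs i \<omega>) n) \<in> measurable M (count_space UNIV)"
  shows "(\<lambda>n. measure M {\<omega> \<in> space M.
            order_estimator \<phi> T pen kbar (\<lambda>i. Xs i \<omega>) n = k\<^sub>0}) \<longlonglongrightarrow> 1"
proof -
  have space: "space \<mm> = \<X>"
    using sets_eq_imp_space_eq[OF sets_m] by (simp add: space_restrict_space)
  obtain \<psi>0 where \<psi>0: "\<psi>0 \<in> param_space T k\<^sub>0" "AE x in \<mm>. f\<^sub>0 x = mixture \<phi> k\<^sub>0 \<psi>0 x"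
    using A1_order(2) by (auto simp: ae_member_def mixture_class_def)
  have T: "T \<noteq> {}" using param_spaceD(3)[OF \<psi>0(1), of 1] A1_order(1) by auto
  have g_meas: "mixture \<phi> k\<^sub>0 \<psi>0 \<in> borel_measurable \<mm>"
    unfolding mixture_def using param_spaceD(3)[OF \<psi>0(1)] A3(2)
    by (intro borel_measurable_sum borel_measurable_times) auto
  have law: "distr M \<mm> (Xs i) = density \<mm> (\<lambda>x. ennreal (mixture \<phi> k\<^sub>0 \<psi>0 x))" if "1 \<le> i" for i
  proof -
    have "distr M \<mm> (Xs i) = density \<mm> (\<lambda>x. ennreal (f\<^sub>0 x))"
      using A1_iid(2) X_density that by (auto simp: distributed_def)
    \<comment> \<open>Changing the density on a null set does not change the law, so the
      observations may be treated as drawn from the mixture itself.\<close>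
    also have "\<dots> = density \<mm> (\<lambda>x. ennreal (mixture \<phi> k\<^sub>0 \<psi>0 x))"
      using X_density \<psi>0(2) g_meas by (intro density_cong) (auto simp: distributed_def)
    finally show ?thesis .
  qed
  interpret prob_space M by (rule prob)
  interpret mixture_sample M \<mm> T \<phi> G\<^sub>2 L Xs k\<^sub>0 \<psi>0
    by unfold_locales (use A1_iid(1) A1_order(1) A2 A3 A5 phi_density \<psi>0(1) law space in auto)
  show ?thesis
  proof (rule order_estimator_consistent)
    \<comment> \<open>Minimality of the order is assumed for \<open>f\<^sub>0\<close> at order
      \<open>k\<^sub>0 - 1\<close> only; nesting of the classes and almost everywhere equality carry
      it over to the mixture at every smaller order.\<close>
    fix k assume "1 \<le> k" "k < k\<^sub>0"
    then have sub: "mixture_class \<phi> T k \<subseteq> mixture_class \<phi> T (k\<^sub>0 - 1)"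
      using T by (intro mixture_class_mono) auto
    show "\<not> ae_member \<mm> (mixture \<phi> k\<^sub>0 \<psi>0) (mixture_class \<phi> T k)"
    proof
      assume "ae_member \<mm> (mixture \<phi> k\<^sub>0 \<psi>0) (mixture_class \<phi> T k)"
      then obtain h where h: "h \<in> mixture_class \<phi> T k" "AE x in \<mm>. mixture \<phi> k\<^sub>0 \<psi>0 x = h x"
        by (auto simp: ae_member_def)
      have "AE x in \<mm>. f\<^sub>0 x = h x" using \<psi>0(2) h(2) by eventually_elim simp
      with h(1) sub A1_order(3) show False by (auto simp: ae_member_def)
    qed
  qed (use A1_order(1) B1 B2 estimator_measurable in auto)
qed

end
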